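(* Let $H$ and $K$ be separable Hilbert spaces, let $V=\{(V_i,v_i)\}_{i\in I}$ be a family of closed subspaces $V_i$ of $H$ with weights $v_i>0$, and let $W=\{(W_j,w_j)\}_{j\in J}$ be a family of closed subspaces $W_j$ of $K$ with weights $w_j>0$. Then $V$ is a fusion frame for $H$ and $W$ is a fusion frame for $K$ if and only if $V\otimes W=\{(V_i\otimes W_j,\,v_iw_j)\}_{(i,j)\in I\times J}$ is a fusion frame for $H\otimes K$.
   Context: $H\otimes K$ is the Hilbert space tensor product, with $\langle f\otimes g,f'\otimes g'\rangle=\langle f,f'\rangle\langle g,g'\rangle$ and $\|f\otimes g\|=\|f\|\|g\|$; $V_i\otimes W_j$ is the closed subspace of $H\otimes K$ given by the tensor product of $V_i$ and $W_j$. $P_X$ denotes the orthogonal projection onto a closed subspace $X$. A family $V=\{(V_i,v_i)\}_{i\in I}$ of closed subspaces of $H$ with weights $v_i>0$ is a fusion frame for $H$ if there exist $0<A\le B<\infty$ (bounds) such that $A\|f\|^2\le\sum_{i\in I}v_i^2\|P_{V_i}f\|^2\le B\|f\|^2$ for all $f\in H$ (similarly for $K$). The family $V\otimes W=\{(V_i\otimes W_j,v_iw_j)\}_{i,j}$ is a fusion frame for $H\otimes K$ if there exist $0<A\le B<\infty$ such that $A\|f\otimes g\|^2\le\sum_{i,j}v_i^2w_j^2\|P_{V_i\otimes W_j}(f\otimes g)\|^2\le B\|f\otimes g\|^2$ for all $f\otimes g\in H\otimes K$ (i.e. for all $f\in H$, $g\in K$).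
   Formalization: The formal theorem additionally assumes H ≠ {0} and K ≠ {0}; otherwise the "if" direction fails (if K = {0}, H ≠ {0} and all V_i = {0}, then V⊗W is trivially a fusion frame for H⊗K = {0} but V is not one for H). *)

theory Defs
  imports "HOL-Analysis.Analysis"
begin

text \<open>The scalar fields $\mathbb{R}$ and $\mathbb{C}$, treated uniformly. The last axiom makes
  $x + \overline{x}$ and $x\overline{x}$ real, so a type of this class is algebraic of degree at
  most two over $\mathbb{R}$, hence isomorphic to one of the two instances below.\<close>

class rc_field = real_normed_field +
  fixes cj :: "'a \<Rightarrow> 'a"
  assumes cj_add: "cj (x + y) = cj x + cj y"
    and cj_mult: "cj (x * y) = cj x * cj y"
    and cj_scaleR_one: "cj (r *\<^sub>R 1) = r *\<^sub>R 1"
    and mult_cj_scaleR: "x * cj x = (norm x)\<^sup>2 *\<^sub>R 1"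

lemma cj_of_real: "cj (of_real r) = (of_real r :: 'k::rc_field)"
  by (simp add: of_real_def cj_scaleR_one)

lemma mult_cj: "x * cj x = (of_real ((norm x)\<^sup>2) :: 'k::rc_field)"
  by (simp only: of_real_def mult_cj_scaleR)

instantiation real :: rc_field
begin
definition cj_real :: "real \<Rightarrow> real" where "cj_real x = x"
instance by standard (auto simp: cj_real_def power2_eq_square)
end

instantiation complex :: rc_field
begin
definition cj_complex :: "complex \<Rightarrow> complex" where "cj_complex = cnj"
instance by standard (auto simp: cj_complex_def complex_norm_square scaleR_conv_of_real simp del: of_real_power)
end

text \<open>Norm, topology and completeness come from the class \<^class>\<open>banach\<close>; the locale
  ties them to the inner product, which is linear in its first argument.\<close>

locale hilbert_space = vector_space scale
  for scale :: "'k::rc_field \<Rightarrow> 'a::banach \<Rightarrow> 'a" +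
  fixes ip :: "'a \<Rightarrow> 'a \<Rightarrow> 'k"
  assumes scale_of_real: "scale (of_real r) x = r *\<^sub>R x"
    and ip_add_left: "ip (x + y) z = ip x z + ip y z"
    and ip_scale_left: "ip (scale a x) y = a * ip x y"
    and ip_commute: "ip y x = cj (ip x y)"
    and ip_self: "ip x x = of_real ((norm x)\<^sup>2)"

definition closed_subspace :: "('k::field \<Rightarrow> 'a::banach \<Rightarrow> 'a) \<Rightarrow> 'a set \<Rightarrow> bool" where
  "closed_subspace scl X \<longleftrightarrow> module.subspace scl X \<and> closed X"

definition orth_proj :: "('a::banach \<Rightarrow> 'a \<Rightarrow> 'k::zero) \<Rightarrow> 'a set \<Rightarrow> 'a \<Rightarrow> 'a" where
  "orth_proj ip X f = (THE p. p \<in> X \<and> (\<forall>x\<in>X. ip (f - p) x = 0))"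

text \<open>The Hilbert space tensor product, unique up to unitary isomorphism: a Hilbert space
  with a bilinear map that is multiplicative on inner products and whose range is total.\<close>

locale hilbert_tensor_product =
  H: hilbert_space scaleH ipH + K: hilbert_space scaleK ipK + T: hilbert_space scaleT ipT
  for scaleH :: "'k::rc_field \<Rightarrow> 'a::banach \<Rightarrow> 'a" and ipH
    and scaleK :: "'k \<Rightarrow> 'b::banach \<Rightarrow> 'b" and ipK
    and scaleT :: "'k \<Rightarrow> 'c::banach \<Rightarrow> 'c" and ipT +
  fixes tensor :: "'a \<Rightarrow> 'b \<Rightarrow> 'c"
  assumes linear_left: "Vector_Spaces.linear scaleH scaleT (\<lambda>f. tensor f g)"
    and linear_right: "Vector_Spaces.linear scaleK scaleT (\<lambda>g. tensor f g)"
    and ip_tensor: "ipT (tensor f g) (tensor f' g') = ipH f f' * ipK g g'"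
    and total: "closure (T.span {tensor f g | f g. True}) = UNIV"

definition subspace_tensor ::
    "('k::field \<Rightarrow> 'c::banach \<Rightarrow> 'c) \<Rightarrow> ('a \<Rightarrow> 'b \<Rightarrow> 'c) \<Rightarrow> 'a set \<Rightarrow> 'b set \<Rightarrow> 'c set" where
  "subspace_tensor scaleT tensor X Y =
     closure (module.span scaleT {tensor x y | x y. x \<in> X \<and> y \<in> Y})"

definition fusion_frame_on ::
    "'a set \<Rightarrow> ('a::banach \<Rightarrow> 'a \<Rightarrow> 'k::zero) \<Rightarrow> 'i set \<Rightarrow> ('i \<Rightarrow> 'a set) \<Rightarrow> ('i \<Rightarrow> real) \<Rightarrow> bool" where
  "fusion_frame_on S ip I V v \<longleftrightarrow>
     (\<exists>A B. 0 < A \<and> A \<le> B \<and>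
       (\<forall>f\<in>S. (\<lambda>i. (v i)\<^sup>2 * (norm (orth_proj ip (V i) f))\<^sup>2) summable_on I \<and>
          A * (norm f)\<^sup>2 \<le> (\<Sum>\<^sub>\<infinity>i\<in>I. (v i)\<^sup>2 * (norm (orth_proj ip (V i) f))\<^sup>2) \<and>
          (\<Sum>\<^sub>\<infinity>i\<in>I. (v i)\<^sup>2 * (norm (orth_proj ip (V i) f))\<^sup>2) \<le> B * (norm f)\<^sup>2))"

definition fusion_frame ::
    "('a::banach \<Rightarrow> 'a \<Rightarrow> 'k::zero) \<Rightarrow> 'i set \<Rightarrow> ('i \<Rightarrow> 'a set) \<Rightarrow> ('i \<Rightarrow> real) \<Rightarrow> bool" where
  "fusion_frame ip I V v \<longleftrightarrow> fusion_frame_on UNIV ip I V v"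

text \<open>On a tensor product the frame inequalities are required for elementary tensors
  $f \otimes g$ only.\<close>

definition tensor_fusion_frame ::
    "('a \<Rightarrow> 'b \<Rightarrow> 'c) \<Rightarrow> ('c::banach \<Rightarrow> 'c \<Rightarrow> 'k::zero) \<Rightarrow> 'i set \<Rightarrow> ('i \<Rightarrow> 'c set) \<Rightarrow> ('i \<Rightarrow> real) \<Rightarrow> bool"
  where
  "tensor_fusion_frame tensor ipT I V v \<longleftrightarrow>
     fusion_frame_on {tensor f g | f g. True} ipT I V v"

lemma hilbert_space_real:
  "hilbert_space scaleR (inner :: 'a::{banach,real_inner} \<Rightarrow> 'a \<Rightarrow> real)"
  by unfold_locales
    (auto simp: cj_real_def inner_add_left inner_commute dot_square_norm algebra_simps)

lemma cj_cj: "cj (cj x) = (x :: 'k::rc_field)"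
proof (cases "x = 0")
  case True
  then show ?thesis using cj_of_real[where 'k='k, of 0] by simp
next
  case False
  have "cj x * cj (cj x) = cj x * x"
    by (metis cj_mult cj_of_real mult_cj mult.commute)
  moreover have "cj x \<noteq> 0"
    using mult_cj[of x] False by auto
  ultimately show ?thesis by simp
qed

lemma hilbert_space_scalars:
  "hilbert_space (*) (\<lambda>x y. x * cj y :: 'k::{rc_field,banach})"
  by unfold_locales
    (auto simp: algebra_simps scaleR_conv_of_real cj_mult cj_cj mult_cj)

text \<open>Two sanity checks of the tensor product: $k \otimes K = K$ for the scalar field $k$, and
  $\mathbb{R}^n \otimes \mathbb{R}^m = \mathbb{R}^{n \times m}$ with the outer product.\<close>

lemma hilbert_tensor_product_scalars:
  fixes scaleK :: "'k::{rc_field,banach} \<Rightarrow> 'b::banach \<Rightarrow> 'b"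
  assumes "hilbert_space scaleK ipK"
  shows "hilbert_tensor_product (*) (\<lambda>x y. x * cj y) scaleK ipK scaleK ipK scaleK"
proof -
  interpret H: hilbert_space "(*)" "\<lambda>x y. x * cj y :: 'k" by (rule hilbert_space_scalars)
  interpret K: hilbert_space scaleK ipK by (rule assms)
  have right: "ipK x (scaleK a y) = cj a * ipK x y" for a x y
    by (metis K.ip_commute K.ip_scale_left cj_mult)
  have "{scaleK f g | f g. True} = UNIV"
    by (metis (mono_tags, lifting) K.scale_one UNIV_eq_I mem_Collect_eq)
  then show ?thesis
    by unfold_locales
      (auto simp: K.scale_left_distrib K.scale_right_distrib K.ip_scale_left right mult.commute)
qed

lemma hilbert_tensor_product_vec:
  "hilbert_tensor_product scaleR inner scaleR inner scaleR inner
     (\<lambda>(x :: real^'n) (y :: real^'m). \<chi> i. \<chi> j. x $ i * y $ j)"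
proof -
  let ?t = "\<lambda>(x :: real^'n) (y :: real^'m). \<chi> i. \<chi> j. x $ i * y $ j"
  interpret H: hilbert_space scaleR "inner :: real^'n \<Rightarrow> _" by (rule hilbert_space_real)
  interpret K: hilbert_space scaleR "inner :: real^'m \<Rightarrow> _" by (rule hilbert_space_real)
  interpret T: hilbert_space scaleR "inner :: real^'m^'n \<Rightarrow> _" by (rule hilbert_space_real)
  have "Z \<in> span {?t x y | x y. True}" for Z :: "real^'m^'n"
  proof -
    have "Z = (\<Sum>i\<in>UNIV. ?t (axis i 1) (Z $ i))"
      by (simp add: vec_eq_iff axis_def if_distrib[of "\<lambda>x. x * _"] cong: if_cong)
    also have "\<dots> \<in> span {?t x y | x y. True}"
      by (intro span_sum span_base) blast
    finally show ?thesis .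
  qed
  then have "span {?t x y | x y. True} = UNIV" by blast
  moreover have "?t x y \<bullet> ?t x' y' = (x \<bullet> x') * (y \<bullet> y')" for x x' y y'
    unfolding inner_vec_def by (subst sum_product) (simp add: inner_vec_def mult_ac)
  ultimately show ?thesis
    by unfold_locales (auto simp: span_raw_def vec_eq_iff algebra_simps)
qed

end

theory Submission
  imports Defs
begin

text \<open>
  Key identity: $P_{X \otimes Y}(f \otimes g) = P_X f \otimes P_Y g$. It makes the fusion frame
  sum of $f \otimes g$ a product of a sum $S(f)$ for $V$ and a sum $S'(g)$ for $W$, so frame bounds
  multiply. Conversely, fix some $g \neq 0$: the lower bound at $f \otimes g$ forces
  $S(f)\,S'(g) > 0$ for $f \neq 0$, hence both sums converge, and dividing the
  inequalities for $f \otimes g$ by the constant $S'(g) > 0$ gives frame bounds for $V$;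
  symmetrically for $W$.
\<close>

text \<open>Taking norms in \<open>mult_cj\<close> and cancelling \<open>norm x\<close>; conjugation
  at 0 is settled separately through \<open>cj_of_real\<close>.\<close>

lemma norm_cj: "norm (cj x) = norm (x :: 'k::rc_field)"
proof (cases "x = 0")
  case True
  then show ?thesis using cj_of_real[where 'k='k, of 0] by simp
next
  case False
  have "norm x * norm (cj x) = (norm x)\<^sup>2"
    using mult_cj[of x] by (metis abs_norm_cancel norm_mult norm_of_real norm_power real_norm_def)
  then show ?thesis using False by (simp add: power2_eq_square)
qed

lemma cj_zero [simp]: "cj 0 = (0 :: 'k::rc_field)"
  using norm_cj[of 0] by simp

section \<open>Hilbert space geometry: Cauchy-Schwarz and orthogonal projections\<close>

context hilbert_space
begin

lemma ip_zero_left [simp]: "ip 0 y = 0"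
  using ip_add_left[of 0 0 y] by simp

lemma ip_zero_right [simp]: "ip y 0 = 0"
  by (metis ip_commute ip_zero_left cj_zero)

lemma ip_diff_left: "ip (x - y) z = ip x z - ip y z"
  using ip_add_left[of "x - y" y z] by (simp add: algebra_simps)

lemma ip_add_right: "ip x (y + z) = ip x y + ip x z"
  by (metis ip_add_left ip_commute cj_add)

lemma ip_diff_right: "ip x (y - z) = ip x y - ip x z"
  using ip_add_right[of x "y - z" z] by (simp add: algebra_simps)

lemma ip_scale_right: "ip x (scale a y) = cj a * ip x y"
  by (metis ip_scale_left ip_commute cj_mult)

text \<open>Norms are real but inner products are scalars, so the identity is expanded in the scalar
  field and pulled back along the injective \<open>of_real\<close>; later norm identities follow the
  same pattern.\<close>

lemma parallelogram_law:
  fixes x y :: 'a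
  shows "(norm (x + y))\<^sup>2 + (norm (x - y))\<^sup>2 = 2 * (norm x)\<^sup>2 + 2 * (norm y)\<^sup>2"
proof -
  have "of_real ((norm (x + y))\<^sup>2 + (norm (x - y))\<^sup>2) =
      (of_real (2 * (norm x)\<^sup>2 + 2 * (norm y)\<^sup>2) :: 'k)"
    unfolding of_real_add of_real_mult ip_self[symmetric]
    by (simp add: ip_add_left ip_add_right ip_diff_left ip_diff_right)
  then show ?thesis by (simp only: of_real_eq_iff)
qed

text \<open>Pythagoras for \<open>x\<close> minus its component along \<open>y\<close>.
  Nonnegativity of the left side yields Cauchy-Schwarz; at a nearest point of a subspace it forces
  orthogonality.\<close>

lemma norm_sub_component:
  assumes "y \<noteq> 0"
  shows "(norm (x - scale (ip x y / of_real ((norm y)\<^sup>2)) y))\<^sup>2 =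
    (norm x)\<^sup>2 - (norm (ip x y))\<^sup>2 / (norm y)\<^sup>2"
proof -
  define n :: 'k where "n = of_real ((norm y)\<^sup>2)"
  define a where "a = ip x y / n"
  have n: "n \<noteq> 0" using assms by (simp add: n_def)
  have an: "a * n = ip x y" using n by (simp add: a_def)
  have c: "a * cj (ip x y) = of_real ((norm (ip x y))\<^sup>2 / (norm y)\<^sup>2)"
    unfolding a_def n_def using mult_cj[of "ip x y"] by simp
  \<comment> \<open>The expansion is grouped so that its last term vanishes by
    \<open>an\<close>.\<close>
  have "of_real ((norm (x - scale a y))\<^sup>2) = ip x x - a * cj (ip x y) - cj a * (ip x y - a * n)"
    unfolding ip_self[symmetric] n_def
    by (simp add: ip_diff_left ip_diff_right ip_scale_left ip_scale_right algebra_simps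
        flip: ip_commute)
  also have "\<dots> = of_real ((norm x)\<^sup>2 - (norm (ip x y))\<^sup>2 / (norm y)\<^sup>2)"
    by (simp only: an c ip_self of_real_diff diff_self mult_zero_right diff_zero)
  finally show ?thesis unfolding a_def n_def by (simp only: of_real_eq_iff)
qed

lemma Cauchy_Schwarz: "norm (ip x y) \<le> norm x * norm y"
proof (cases "y = 0")
  case False
  have "0 \<le> (norm x)\<^sup>2 - (norm (ip x y))\<^sup>2 / (norm y)\<^sup>2"
    using norm_sub_component[OF False, of x] by (metis zero_le_power2)
  then have "(norm (ip x y))\<^sup>2 \<le> (norm x * norm y)\<^sup>2"
    using False by (simp add: field_simps)
  then show ?thesis by (rule power2_le_imp_le) simp
qed simp

lemma continuous_ip_right: "continuous_on S (ip x)"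
proof (rule continuous_onI)
  fix y and e :: real
  assume "0 < e"
  moreover have "dist (ip x z) (ip x y) < e" if "dist z y < e / (norm x + 1)" for z
  proof -
    have "dist (ip x z) (ip x y) \<le> norm x * norm (z - y)"
      using Cauchy_Schwarz[of x "z - y"] by (simp add: dist_norm ip_diff_right)
    \<comment> \<open>The \<open>+ 1\<close> keeps the radius \<open>e / (norm x + 1)\<close>
      meaningful for \<open>x = 0\<close>.\<close>
    also have "\<dots> \<le> (norm x + 1) * norm (z - y)" by (simp add: mult_right_mono)
    also have "\<dots> < e"
      using that by (simp add: dist_norm pos_less_divide_eq add_nonneg_pos mult.commute)
    finally show ?thesis .
  qed
  ultimately show "\<exists>d>0. \<forall>z\<in>S. dist z y < d \<longrightarrow> dist (ip x z) (ip x y) \<le> e"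
    by (intro exI[of _ "e / (norm x + 1)"]) (auto simp: add_nonneg_pos less_imp_le)
qed

text \<open>The kernel of \<open>ip d\<close> is closed under linear combinations and, by
  continuity, topologically closed. Orthogonality to a tensor product of subspaces can thus be
  tested on elementary tensors.\<close>

lemma orthogonal_closure_span:
  assumes "\<And>x. x \<in> G \<Longrightarrow> ip d x = 0" and "y \<in> closure (span G)"
  shows "ip d y = 0"
proof -
  have "ip d x = 0" if "x \<in> span G" for x
    using that by (induction rule: span_induct_alt) (simp_all add: assms ip_add_right ip_scale_right)
  then have sub: "span G \<subseteq> ip d -` {0}" by auto
  have "closed (ip d -` {0})"
    by (intro closed_vimage closed_singleton continuous_ip_right)
  then have "closure (span G) \<subseteq> ip d -` {0}" using sub by (rule closure_minimal[rotated])
  then show ?thesis using assms(2) by auto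
qed

text \<open>A sequence in \<open>X\<close> minimizing the squared distance to \<open>f\<close> is
  Cauchy; completeness gives a limit, closedness keeps it in \<open>X\<close>, and continuity of the
  norm makes it a minimizer.\<close>

lemma nearest_point_exists:
  assumes "closed_subspace scale X"
  shows "\<exists>p\<in>X. \<forall>x\<in>X. norm (f - p) \<le> norm (f - x)"
proof -
  have sub: "subspace X" and cl: "closed X" using assms by (auto simp: closed_subspace_def)
  define D where "D = (\<lambda>x. (norm (f - x))\<^sup>2) ` X"
  define d where "d = Inf D"
  have ne: "D \<noteq> {}" using subspace_0[OF sub] by (auto simp: D_def)
  have bdd: "bdd_below D" by (rule bdd_belowI[of _ 0]) (auto simp: D_def)
  have d_le: "d \<le> (norm (f - x))\<^sup>2" if "x \<in> X" for x
    unfolding d_def by (rule cInf_lower[OF _ bdd]) (use that in \<open>auto simp: D_def\<close>)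
  have "\<exists>x\<in>X. (norm (f - x))\<^sup>2 < d + inverse (Suc n)" for n
  proof -
    have "\<exists>r\<in>D. r < d + inverse (Suc n)"
      unfolding d_def cInf_less_iff[OF ne bdd, symmetric] by simp
    then show ?thesis by (auto simp: D_def)
  qed
  then obtain s where sX: "\<And>n. s n \<in> X"
    and s: "\<And>n. (norm (f - s n))\<^sup>2 < d + inverse (Suc n)" by metis
  have near: "(norm (s m - s n))\<^sup>2 \<le> 2 * inverse (Suc m) + 2 * inverse (Suc n)" for m n
  proof -
    \<comment> \<open>The midpoint lies in \<open>X\<close>, so the parallelogram law bounds the distance of near-minimizers.\<close>
    let ?c = "scale (of_real (1/2)) (s m + s n)"
    have "?c \<in> X" by (intro subspace_scale subspace_add sub sX)
    moreover have "(f - s m) + (f - s n) = 2 *\<^sub>R (f - ?c)"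
      unfolding scale_of_real by (simp add: algebra_simps scaleR_2)
    ultimately have "4 * d \<le> (norm ((f - s m) + (f - s n)))\<^sup>2"
      using d_le[of ?c] by (simp add: power_mult_distrib)
    then show ?thesis
      using parallelogram_law[of "f - s m" "f - s n"] s[of m] s[of n]
      by (simp add: norm_minus_commute)
  qed
  have "Cauchy s"
  proof (rule metric_CauchyI)
    fix e :: real assume e: "0 < e"
    \<comment> \<open>Each of the two terms in \<open>near\<close> is then below half of the square
      of \<open>e\<close>.\<close>
    then have "0 < e\<^sup>2 / 4" by simp
    then obtain N where N: "inverse (real (Suc N)) < e\<^sup>2 / 4" using reals_Archimedean by blast
    have "dist (s m) (s n) < e" if "N \<le> m" "N \<le> n" for m n
    proof -
      have "inverse (real (Suc m)) \<le> inverse (real (Suc N))"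
        "inverse (real (Suc n)) \<le> inverse (real (Suc N))"
        using that by (simp_all add: field_simps)
      then have "(norm (s m - s n))\<^sup>2 < e\<^sup>2" using near[of m n] N by linarith
      then show ?thesis using e by (simp add: dist_norm power2_less_imp_less)
    qed
    then show "\<exists>M. \<forall>m\<ge>M. \<forall>n\<ge>M. dist (s m) (s n) < e" by blast
  qed
  then obtain p where p: "s \<longlonglongrightarrow> p" using Cauchy_convergent convergent_def by blast
  have "p \<in> X" using closed_sequentially[OF cl] sX p by blast
  moreover have "(norm (f - p))\<^sup>2 \<le> d"
  proof (rule LIMSEQ_le)
    show "(\<lambda>n. (norm (f - s n))\<^sup>2) \<longlonglongrightarrow> (norm (f - p))\<^sup>2" by (intro tendsto_intros p)
    show "(\<lambda>n. d + inverse (real (Suc n))) \<longlonglongrightarrow> d"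
      using tendsto_add[OF tendsto_const[of d] LIMSEQ_inverse_real_of_nat] by simp
    show "\<exists>N. \<forall>n\<ge>N. (norm (f - s n))\<^sup>2 \<le> d + inverse (real (Suc n))"
      using s by (auto intro: less_imp_le)
  qed
  ultimately show ?thesis
    using d_le by (meson norm_ge_zero order_trans power2_le_imp_le)
qed

text \<open>A nearest point \<open>p\<close> works: if \<open>f - p\<close> had a nonzero component
  along some \<open>x\<close> in \<open>X\<close>, adding that component to \<open>p\<close> would
  give a point of \<open>X\<close> strictly closer to \<open>f\<close>.\<close>

lemma orthogonal_decomposition:
  assumes "closed_subspace scale X"
  shows "\<exists>p\<in>X. \<forall>x\<in>X. ip (f - p) x = 0"
proof -
  have sub: "subspace X" using assms by (auto simp: closed_subspace_def)
  obtain p where p: "p \<in> X" and le: "\<And>x. x \<in> X \<Longrightarrow> norm (f - p) \<le> norm (f - x)"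
    using nearest_point_exists[OF assms, of f] by blast
  have "ip (f - p) x = 0" if x: "x \<in> X" for x
  proof (cases "x = 0")
    case False
    define a where "a = ip (f - p) x / of_real ((norm x)\<^sup>2)"
    have "p + scale a x \<in> X" by (intro subspace_add subspace_scale sub p x)
    then have "(norm (f - p))\<^sup>2 \<le> (norm (f - p - scale a x))\<^sup>2"
      using le[of "p + scale a x"] by (simp add: diff_diff_eq power_mono)
    also have "\<dots> = (norm (f - p))\<^sup>2 - (norm (ip (f - p) x))\<^sup>2 / (norm x)\<^sup>2"
      unfolding a_def by (rule norm_sub_component[OF False])
    finally show ?thesis
      using False by (simp add: divide_le_0_iff)
  qed simp
  then show ?thesis using p by blast
qed

text \<open>Uniqueness behind the definite description: the difference of two candidates lies in
  \<open>X\<close> and is orthogonal to \<open>X\<close>, hence to itself.\<close>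

lemma orth_proj_eqI:
  assumes "subspace X" "p \<in> X" "\<And>x. x \<in> X \<Longrightarrow> ip (f - p) x = 0"
  shows "orth_proj ip X f = p"
  unfolding orth_proj_def
proof (rule the_equality)
  fix q assume q: "q \<in> X \<and> (\<forall>x\<in>X. ip (f - q) x = 0)"
  then have "p - q \<in> X" using assms by (blast intro: subspace_diff)
  then have "ip (f - q) (p - q) - ip (f - p) (p - q) = 0" using q assms by simp
  then have "ip (p - q) (p - q) = 0" by (simp add: ip_diff_left)
  then show "q = p" by (simp add: ip_self)
qed (use assms in auto)

lemma orth_proj:
  assumes "closed_subspace scale X"
  shows "orth_proj ip X f \<in> X" and "\<And>x. x \<in> X \<Longrightarrow> ip (f - orth_proj ip X f) x = 0"
proof -
  obtain p where p: "p \<in> X" "\<forall>x\<in>X. ip (f - p) x = 0"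
    using orthogonal_decomposition[OF assms, of f] by blast
  moreover have "orth_proj ip X f = p"
    using assms p by (intro orth_proj_eqI) (auto simp: closed_subspace_def)
  ultimately show "orth_proj ip X f \<in> X" "\<And>x. x \<in> X \<Longrightarrow> ip (f - orth_proj ip X f) x = 0"
    by auto
qed

lemma orth_proj_zero: "closed_subspace scale X \<Longrightarrow> orth_proj ip X 0 = 0"
  by (rule orth_proj_eqI) (auto simp: closed_subspace_def subspace_0)

lemma norm_scale: "norm (scale a y) = norm a * norm y"
proof -
  have "of_real ((norm (scale a y))\<^sup>2) = (of_real ((norm a * norm y)\<^sup>2) :: 'k)"
    unfolding power_mult_distrib of_real_mult mult_cj[symmetric] ip_self[symmetric]
    by (simp add: ip_scale_left ip_scale_right)
  then have "(norm (scale a y))\<^sup>2 = (norm a * norm y)\<^sup>2" by (simp only: of_real_eq_iff)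
  then show ?thesis by (rule power2_eq_imp_eq) simp_all
qed

text \<open>Addition and scaling are continuous, so they pass to limits of sequences; for scaling
  this rests on \<open>norm_scale\<close>. The lemma makes \<open>subspace_tensor\<close> a
  subspace, as \<open>orth_proj_eqI\<close> requires.\<close>

lemma subspace_closure:
  assumes "subspace X"
  shows "subspace (closure X)"
proof (rule subspaceI)
  show "0 \<in> closure X" using subspace_0[OF assms] closure_subset by blast
next
  fix x y assume "x \<in> closure X" "y \<in> closure X"
  then obtain s t where "\<And>n. s n \<in> X" "s \<longlonglongrightarrow> x" "\<And>n. t n \<in> X" "t \<longlonglongrightarrow> y"
    unfolding closure_sequential by blast
  then show "x + y \<in> closure X" unfolding closure_sequential
    by (intro exI[of _ "\<lambda>n. s n + t n"]) (auto intro: tendsto_add subspace_add[OF assms])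
next
  fix a :: 'k and x assume "x \<in> closure X"
  then obtain s where s: "\<And>n. s n \<in> X" "s \<longlonglongrightarrow> x" unfolding closure_sequential by blast
  have "(\<lambda>n. norm (s n - x)) \<longlonglongrightarrow> 0"
    by (rule tendsto_norm_zero[OF LIM_zero[OF s(2)]])
  from tendsto_mult_right_zero[OF this, of "norm a"]
  have "(\<lambda>n. norm (scale a (s n) - scale a x)) \<longlonglongrightarrow> 0"
    by (simp only: norm_scale scale_right_diff_distrib[symmetric])
  then have "(\<lambda>n. scale a (s n)) \<longlonglongrightarrow> scale a x"
    by (rule LIM_zero_cancel[OF tendsto_norm_zero_cancel])
  then show "scale a x \<in> closure X" unfolding closure_sequential
    by (intro exI[of _ "\<lambda>n. scale a (s n)"]) (simp add: s(1) subspace_scale[OF assms])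
qed

end

section \<open>Orthogonal projections of elementary tensors\<close>

context hilbert_tensor_product
begin

lemma norm_tensor: "norm (tensor f g) = norm f * norm g"
proof -
  have "of_real ((norm (tensor f g))\<^sup>2) = (of_real ((norm f * norm g)\<^sup>2) :: 'k)"
    unfolding power_mult_distrib of_real_mult
    by (simp only: T.ip_self[symmetric] H.ip_self[symmetric] K.ip_self[symmetric] ip_tensor)
  then have "(norm (tensor f g))\<^sup>2 = (norm f * norm g)\<^sup>2" by (simp only: of_real_eq_iff)
  then show ?thesis by (rule power2_eq_imp_eq) simp_all
qed

text \<open>Against a generator \<open>tensor x y\<close>, the vectors \<open>f\<close> and
  \<open>g\<close> have the same inner products as their projections, so the products of inner
  products agree and the residual is orthogonal to every generator, hence to their closed
  span.\<close>

lemma orth_proj_tensor: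
  assumes X: "closed_subspace scaleH X" and Y: "closed_subspace scaleK Y"
  shows "orth_proj ipT (subspace_tensor scaleT tensor X Y) (tensor f g) =
    tensor (orth_proj ipH X f) (orth_proj ipK Y g)"
proof (rule T.orth_proj_eqI)
  let ?p = "orth_proj ipH X f" and ?q = "orth_proj ipK Y g"
  note p = H.orth_proj[OF X, where f = f] and q = K.orth_proj[OF Y, where f = g]
  show "T.subspace (subspace_tensor scaleT tensor X Y)"
    unfolding subspace_tensor_def by (intro T.subspace_closure T.subspace_span)
  have "tensor ?p ?q \<in> T.span {tensor x y |x y. x \<in> X \<and> y \<in> Y}"
    using p(1) q(1) by (intro T.span_base) blast
  then show "tensor ?p ?q \<in> subspace_tensor scaleT tensor X Y"
    unfolding subspace_tensor_def using closure_subset by blast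
  fix z assume "z \<in> subspace_tensor scaleT tensor X Y"
  then show "ipT (tensor f g - tensor ?p ?q) z = 0"
    unfolding subspace_tensor_def
  proof (rule T.orthogonal_closure_span[rotated])
    fix u assume "u \<in> {tensor x y |x y. x \<in> X \<and> y \<in> Y}"
    then obtain x y where u: "u = tensor x y" and x: "x \<in> X" and y: "y \<in> Y" by blast
    have "ipH f x = ipH ?p x" "ipK g y = ipK ?q y"
      using p(2)[OF x] q(2)[OF y] by (simp_all add: H.ip_diff_left K.ip_diff_left)
    then show "ipT (tensor f g - tensor ?p ?q) u = 0"
      by (simp add: u T.ip_diff_left ip_tensor)
  qed
qed

end

section \<open>Infinite double sums of products\<close>

lemma infsum_times:
  fixes a :: "'i \<Rightarrow> real" and b :: "'j \<Rightarrow> real"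
  assumes "(\<lambda>(i, j). a i * b j) summable_on I \<times> J"
  shows "(\<Sum>\<^sub>\<infinity>(i, j)\<in>I \<times> J. a i * b j) = (\<Sum>\<^sub>\<infinity>i\<in>I. a i) * (\<Sum>\<^sub>\<infinity>j\<in>J. b j)"
  \<comment> \<open>Fubini, then constants are pulled out of sums by rules that hold without
    summability. So the factorization is available before the factors are known to be
    summable.\<close>
  using infsum_Sigma_banach[OF assms] by (simp add: infsum_cmult_right' infsum_cmult_left')

lemma summable_on_times:
  fixes a :: "'i \<Rightarrow> real" and b :: "'j \<Rightarrow> real"
  assumes "a summable_on I" "b summable_on J"
    and "\<And>i. i \<in> I \<Longrightarrow> 0 \<le> a i" "\<And>j. j \<in> J \<Longrightarrow> 0 \<le> b j"
  shows "(\<lambda>(i, j). a i * b j) summable_on I \<times> J"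
proof (rule summable_on_SigmaI)
  show "((\<lambda>j. case (i, j) of (i, j) \<Rightarrow> a i * b j) has_sum a i * infsum b J) J" for i
    using assms(2) by (simp add: has_sum_cmult_right)
  show "(\<lambda>i. a i * infsum b J) summable_on I" using assms(1) by (rule summable_on_cmult_left)
qed (use assms in auto)

text \<open>\<open>infsum\<close> is 0 on a family that is not summable, so by
  \<open>infsum_times\<close> a factor that fails to be summable would make the double sum
  0.\<close>

lemma summable_on_factors:
  fixes a :: "'i \<Rightarrow> real" and b :: "'j \<Rightarrow> real"
  assumes "(\<lambda>(i, j). a i * b j) summable_on I \<times> J"
    and "(\<Sum>\<^sub>\<infinity>(i, j)\<in>I \<times> J. a i * b j) \<noteq> 0"
  shows "a summable_on I" "b summable_on J"
  using assms infsum_times[OF assms(1)] infsum_not_exists by fastforce+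

text \<open>In the application \<open>c\<close> is the frame sum of a fixed nonzero vector in the
  other space; the frame bounds are \<open>A / c\<close> and \<open>B / c\<close>.\<close>

lemma fusion_frameI_scaled:
  assumes "0 < A" "A \<le> B" "0 < c"
    and "\<And>f. (\<lambda>i. (v i)\<^sup>2 * (norm (orth_proj ip (V i) f))\<^sup>2) summable_on I"
    and "\<And>f. A * (norm f)\<^sup>2 \<le> c * (\<Sum>\<^sub>\<infinity>i\<in>I. (v i)\<^sup>2 * (norm (orth_proj ip (V i) f))\<^sup>2)"
    and "\<And>f. c * (\<Sum>\<^sub>\<infinity>i\<in>I. (v i)\<^sup>2 * (norm (orth_proj ip (V i) f))\<^sup>2) \<le> B * (norm f)\<^sup>2"
  shows "fusion_frame ip I V v"
  unfolding fusion_frame_def fusion_frame_on_def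
  using assms
  by (intro exI[of _ "A / c"] exI[of _ "B / c"])
    (auto simp: divide_right_mono pos_divide_le_eq pos_le_divide_eq mult.commute)

theorem theorem3p4:
  fixes scaleH :: "'k::rc_field \<Rightarrow> 'a::banach \<Rightarrow> 'a" and ipH :: "'a \<Rightarrow> 'a \<Rightarrow> 'k"
    and scaleK :: "'k \<Rightarrow> 'b::banach \<Rightarrow> 'b" and ipK :: "'b \<Rightarrow> 'b \<Rightarrow> 'k"
    and scaleT :: "'k \<Rightarrow> 'c::banach \<Rightarrow> 'c" and ipT :: "'c \<Rightarrow> 'c \<Rightarrow> 'k"
    and tensor :: "'a \<Rightarrow> 'b \<Rightarrow> 'c"
    and I :: "'i set" and V :: "'i \<Rightarrow> 'a set" and v :: "'i \<Rightarrow> real"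
    and J :: "'j set" and W :: "'j \<Rightarrow> 'b set" and w :: "'j \<Rightarrow> real"
  assumes "hilbert_space scaleH ipH" and "hilbert_space scaleK ipK"
    and "separable_space (euclidean :: 'a topology)"
    and "separable_space (euclidean :: 'b topology)"
    and "(UNIV :: 'a set) \<noteq> {0}" and "(UNIV :: 'b set) \<noteq> {0}"
    and "hilbert_tensor_product scaleH ipH scaleK ipK scaleT ipT tensor"
    and "\<And>i. i \<in> I \<Longrightarrow> closed_subspace scaleH (V i)" and "\<And>i. i \<in> I \<Longrightarrow> 0 < v i"
    and "\<And>j. j \<in> J \<Longrightarrow> closed_subspace scaleK (W j)" and "\<And>j. j \<in> J \<Longrightarrow> 0 < w j"
  shows "fusion_frame ipH I V v \<and> fusion_frame ipK J W w \<longleftrightarrow>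
    tensor_fusion_frame tensor ipT (I \<times> J)
      (\<lambda>(i, j). subspace_tensor scaleT tensor (V i) (W j)) (\<lambda>(i, j). v i * w j)"
proof -
  interpret hilbert_tensor_product scaleH ipH scaleK ipK scaleT ipT tensor by fact
  define a where "a f i = (v i)\<^sup>2 * (norm (orth_proj ipH (V i) f))\<^sup>2" for f i
  define b where "b g j = (w j)\<^sup>2 * (norm (orth_proj ipK (W j) g))\<^sup>2" for g j
  let ?t = "\<lambda>f g (i, j). a f i * b g j"
  have a_nonneg: "0 \<le> a f i" and b_nonneg: "0 \<le> b g j" for f g i j
    by (simp_all add: a_def b_def)
  \<comment> \<open>The zero vector is treated apart: positivity of the double sum, which gives
    summability below, is only available for nonzero vectors.\<close>
  have a_zero: "a 0 i = 0" if "i \<in> I" for i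
    using assms(8)[OF that] by (simp add: a_def H.orth_proj_zero)
  have b_zero: "b 0 j = 0" if "j \<in> J" for j
    using assms(10)[OF that] by (simp add: b_def K.orth_proj_zero)
  \<comment> \<open>By \<open>orth_proj_tensor\<close> and \<open>norm_tensor\<close>, each term of
    the frame sum of \<open>tensor f g\<close> splits into a term for \<open>f\<close> times a term
    for \<open>g\<close>.\<close>
  have proj: "(case p of (i, j) \<Rightarrow> v i * w j)\<^sup>2 *
      (norm (orth_proj ipT (case p of (i, j) \<Rightarrow> subspace_tensor scaleT tensor (V i) (W j))
        (tensor f g)))\<^sup>2 = ?t f g p" if "p \<in> I \<times> J" for f g p
    using that assms(8,10)
    by (auto simp: a_def b_def orth_proj_tensor norm_tensor power_mult_distrib mult_ac)
  have tensor_frame_iff: "tensor_fusion_frame tensor ipT (I \<times> J)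
      (\<lambda>(i, j). subspace_tensor scaleT tensor (V i) (W j)) (\<lambda>(i, j). v i * w j) \<longleftrightarrow>
    (\<exists>A B. 0 < A \<and> A \<le> B \<and> (\<forall>f g. ?t f g summable_on I \<times> J \<and>
      A * ((norm f)\<^sup>2 * (norm g)\<^sup>2) \<le> infsum (?t f g) (I \<times> J) \<and>
      infsum (?t f g) (I \<times> J) \<le> B * ((norm f)\<^sup>2 * (norm g)\<^sup>2)))"
  proof -
    have ball: "(\<forall>h\<in>{tensor f g | f g. True}. P h) \<longleftrightarrow> (\<forall>f g. P (tensor f g))" for P by auto
    show ?thesis
      unfolding tensor_fusion_frame_def fusion_frame_on_def ball
      by (simp add: proj norm_tensor power_mult_distrib cong: summable_on_cong infsum_cong)
  qed
  show ?thesis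
  proof
    assume "fusion_frame ipH I V v \<and> fusion_frame ipK J W w"
    then obtain A B C D where AB: "0 < A" "A \<le> B" and CD: "0 < C" "C \<le> D"
      and a: "\<And>f. a f summable_on I" "\<And>f. A * (norm f)\<^sup>2 \<le> infsum (a f) I"
        "\<And>f. infsum (a f) I \<le> B * (norm f)\<^sup>2"
      and b: "\<And>g. b g summable_on J" "\<And>g. C * (norm g)\<^sup>2 \<le> infsum (b g) J"
        "\<And>g. infsum (b g) J \<le> D * (norm g)\<^sup>2"
      unfolding fusion_frame_def fusion_frame_on_def a_def b_def by auto
    have t: "?t f g summable_on I \<times> J" for f g
      by (intro summable_on_times a b a_nonneg b_nonneg)
    \<comment> \<open>The bounds for the tensor family are the products of the given ones;
      \<open>mult_mono\<close> applies because all factors involved are nonnegative.\<close>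
    have "(A * C) * ((norm f)\<^sup>2 * (norm g)\<^sup>2) \<le> infsum (?t f g) (I \<times> J)" for f g
      using mult_mono[OF a(2)[of f] b(2)[of g]] CD
      by (simp add: infsum_times[OF t] infsum_nonneg a_nonneg mult_ac)
    moreover have "infsum (?t f g) (I \<times> J) \<le> (B * D) * ((norm f)\<^sup>2 * (norm g)\<^sup>2)" for f g
      using mult_mono[OF a(3)[of f] b(3)[of g]] AB
      by (simp add: infsum_times[OF t] infsum_nonneg b_nonneg mult_ac)
    moreover have "0 < A * C" "A * C \<le> B * D" using AB CD by (auto intro: mult_mono)
    ultimately show "tensor_fusion_frame tensor ipT (I \<times> J)
        (\<lambda>(i, j). subspace_tensor scaleT tensor (V i) (W j)) (\<lambda>(i, j). v i * w j)"
      unfolding tensor_frame_iff using t by blast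
  next
    assume "tensor_fusion_frame tensor ipT (I \<times> J)
        (\<lambda>(i, j). subspace_tensor scaleT tensor (V i) (W j)) (\<lambda>(i, j). v i * w j)"
    then obtain A B where AB: "0 < A" "A \<le> B" and t: "\<And>f g. ?t f g summable_on I \<times> J"
      and "\<And>f g. A * ((norm f)\<^sup>2 * (norm g)\<^sup>2) \<le> infsum (?t f g) (I \<times> J)"
      and "\<And>f g. infsum (?t f g) (I \<times> J) \<le> B * ((norm f)\<^sup>2 * (norm g)\<^sup>2)"
      unfolding tensor_frame_iff by auto
    then have lower: "A * ((norm f)\<^sup>2 * (norm g)\<^sup>2) \<le> infsum (a f) I * infsum (b g) J"
      and upper: "infsum (a f) I * infsum (b g) J \<le> B * ((norm f)\<^sup>2 * (norm g)\<^sup>2)" for f g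
      by (simp_all add: infsum_times[OF t, symmetric])
    \<comment> \<open>Nontriviality of both spaces supplies a fixed test vector in each, to be
      paired with arbitrary vectors of the other space.\<close>
    obtain f0 :: 'a and g0 :: 'b where ne: "f0 \<noteq> 0" "g0 \<noteq> 0" using assms(5,6) by auto
    have pos: "0 < infsum (a f) I * infsum (b g) J" if "f \<noteq> 0" "g \<noteq> 0" for f g
      using lower[of f g] AB(1) that by (intro less_le_trans[OF _ lower]) simp
    have a_sum: "a f summable_on I" for f
    proof (cases "f = 0")
      case True
      then show ?thesis using a_zero by (simp cong: summable_on_cong)
    next
      case False
      then show ?thesis using summable_on_factors(1)[OF t] infsum_times[OF t] pos[OF _ ne(2)]
        by (metis less_irrefl)
    qed
    have b_sum: "b g summable_on J" for g
    proof (cases "g = 0")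
      case True
      then show ?thesis using b_zero by (simp cong: summable_on_cong)
    next
      case False
      then show ?thesis using summable_on_factors(2)[OF t] infsum_times[OF t] pos[OF ne(1)]
        by (metis less_irrefl)
    qed
    \<comment> \<open>Two nonnegative sums with a positive product are both positive, so they can
      serve as divisors.\<close>
    have a_pos: "0 < infsum (a f0) I" and b_pos: "0 < infsum (b g0) J"
      using pos[OF ne] infsum_nonneg[of I "a f0"] infsum_nonneg[of J "b g0"] a_nonneg b_nonneg
      by (auto simp: zero_less_mult_iff)
    \<comment> \<open>With \<open>g = g0\<close> fixed, the squared norm of \<open>g0\<close> is
      absorbed into the constants and \<open>infsum (b g0) J\<close> is the scaling factor.\<close>
    have "fusion_frame ipH I V v"
      by (rule fusion_frameI_scaled[of "A * (norm g0)\<^sup>2" "B * (norm g0)\<^sup>2" "infsum (b g0) J"])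
        (use AB ne b_pos a_sum lower[of _ g0] upper[of _ g0] in
          \<open>simp_all add: a_def[symmetric] mult_ac\<close>)
    moreover have "fusion_frame ipK J W w"
      by (rule fusion_frameI_scaled[of "A * (norm f0)\<^sup>2" "B * (norm f0)\<^sup>2" "infsum (a f0) I"])
        (use AB ne a_pos b_sum lower[of f0] upper[of f0] in
          \<open>simp_all add: b_def[symmetric] mult_ac\<close>)
    ultimately show "fusion_frame ipH I V v \<and> fusion_frame ipK J W w" ..
  qed
qed

end
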